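(* Consider the flow-level coflow scheduling problem on $m$ identical parallel network cores, defined in the context below. Let FLS be the following algorithm. Initialize $load_I(i,h)=0$ and $load_O(j,h)=0$ for all input ports $i$, output ports $j$ and cores $h\in\{1,\dots,m\}$, and $\mathcal{A}_h=\emptyset$ for all $h$. For each flow $(i,j,k)\in\mathcal{F}$, taken in an arbitrary order, let $h^*=\arg\min_{h}\{load_I(i,h)+load_O(j,h)\}$; add $(i,j,k)$ to $\mathcal{A}_{h^*}$ and increase both $load_I(i,h^* )$ and $load_O(j,h^* )$ by $d_{i,j,k}$. Output the assignment $\{\mathcal{A}_h\}_{h=1}^m$ (every flow of $\mathcal{A}_h$ is transmitted entirely on core $h$). Then FLS is a $\left(3-\frac{2}{m}\right)$-approximation algorithm: if $T$ is the makespan of the schedule found by FLS and $T^*$ is the optimal makespan, then $T\le \left(3-\frac{2}{m}\right)T^*$.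
   Context: Identical parallel networks: there are $m$ network cores, each a non-blocking $N\times N$ switch with input ports $\mathcal{I}=\{1,\dots,N\}$ and output ports $\mathcal{J}=\{1,\dots,N\}$; the $i$-th source server is connected to input port $i$ of every core and the $j$-th destination server to output port $j$ of every core. Every port of every core can transfer at most one unit of data per unit of time. A set $\mathcal{K}=\{1,\dots,K\}$ of coflows is given, all released at time $0$; coflow $k$ is an $N\times N$ matrix $D^{(k)}$ of nonnegative integers, and each nonzero entry $d_{i,j,k}$ is a flow $(i,j,k)$ that must transfer $d_{i,j,k}$ units of data from input port $i$ to output port $j$. $\mathcal{F}$ is the set of all flows. In the flow-level scheduling problem, each flow must be transmitted entirely through a single core (flows may not be split across cores), but different flows of the same coflow may use different cores. The completion time $C_k$ of coflow $k$ is the time at which its last flow finishes, and the makespan is $\max_k C_k$; $T^*$ denotes the minimum makespan over all feasible flow-level schedules. *)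

theory Defs
  imports "HOL-Analysis.Analysis"
begin

text \<open>
  An instance is given by the number of ports \<open>N\<close>, the number of cores \<open>m\<close>, the number of
  coflows \<open>K\<close> and the demands \<open>d i j k\<close>; only the entries with
  \<open>i, j \<in> {1..N}\<close> and \<open>k \<in> {1..K}\<close> are relevant.
\<close>

type_synonym demands = "nat \<Rightarrow> nat \<Rightarrow> nat \<Rightarrow> nat"

text \<open>A flow is a triple (input port, output port, coflow).\<close>

type_synonym flow = "nat \<times> nat \<times> nat"

definition flows :: "nat \<Rightarrow> nat \<Rightarrow> demands \<Rightarrow> flow set" where
  "flows N K d = {(i, j, k). i \<in> {1..N} \<and> j \<in> {1..N} \<and> k \<in> {1..K} \<and> d i j k \<noteq> 0}"

text \<open>
  Time is continuous. A schedule sends each flow through one core, at a time-dependent rate;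
  preemption and sharing of a port are allowed, as only the port capacities constrain a
  non-blocking switch.
\<close>

record schedule =
  core :: "flow \<Rightarrow> nat"
  rate :: "flow \<Rightarrow> real \<Rightarrow> real"

definition transmitted :: "schedule \<Rightarrow> flow \<Rightarrow> real \<Rightarrow> real" where
  "transmitted \<sigma> f t = integral {0..t} (rate \<sigma> f)"

definition feasible :: "nat \<Rightarrow> nat \<Rightarrow> nat \<Rightarrow> demands \<Rightarrow> schedule \<Rightarrow> bool" where
  "feasible N m K d \<sigma> \<longleftrightarrow>
     (\<forall>f\<in>flows N K d. core \<sigma> f \<in> {1..m}) \<and>
     (\<forall>f\<in>flows N K d. \<forall>t\<ge>0. rate \<sigma> f t \<ge> 0 \<and> rate \<sigma> f integrable_on {0..t}) \<and>
     (\<forall>h\<in>{1..m}. \<forall>i\<in>{1..N}. \<forall>t\<ge>0.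
        (\<Sum>f\<in>{(i', j, k)\<in>flows N K d. i' = i \<and> core \<sigma> (i', j, k) = h}. rate \<sigma> f t) \<le> 1) \<and>
     (\<forall>h\<in>{1..m}. \<forall>j\<in>{1..N}. \<forall>t\<ge>0.
        (\<Sum>f\<in>{(i, j', k)\<in>flows N K d. j' = j \<and> core \<sigma> (i, j', k) = h}. rate \<sigma> f t) \<le> 1) \<and>
     (\<forall>(i, j, k)\<in>flows N K d. \<exists>t\<ge>0. transmitted \<sigma> (i, j, k) t \<ge> real (d i j k))"

text \<open>
  In a feasible schedule the infimum is attained, since the transmitted amount is continuous in time.
\<close>

definition flow_completion :: "demands \<Rightarrow> schedule \<Rightarrow> flow \<Rightarrow> real" where
  "flow_completion d \<sigma> = (\<lambda>(i, j, k). Inf {t. t \<ge> 0 \<and> transmitted \<sigma> (i, j, k) t \<ge> real (d i j k)})"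

text \<open>A coflow without flows is complete at its release time \<open>0\<close>.\<close>

definition coflow_completion :: "nat \<Rightarrow> nat \<Rightarrow> demands \<Rightarrow> schedule \<Rightarrow> nat \<Rightarrow> real" where
  "coflow_completion N K d \<sigma> k =
     Max (insert 0 (flow_completion d \<sigma> ` {(i, j, k')\<in>flows N K d. k' = k}))"

definition makespan :: "nat \<Rightarrow> nat \<Rightarrow> demands \<Rightarrow> schedule \<Rightarrow> real" where
  "makespan N K d \<sigma> = Max (insert 0 (coflow_completion N K d \<sigma> ` {1..K}))"

definition opt_makespan :: "nat \<Rightarrow> nat \<Rightarrow> nat \<Rightarrow> demands \<Rightarrow> real" where
  "opt_makespan N m K d = Inf (makespan N K d ` {\<sigma>. feasible N m K d \<sigma>})"

text \<open>
  \<open>fls m d fs LI LO A\<close>: after processing the flows in the order \<open>fs\<close>, the algorithm can have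
  reached the loads \<open>LI i h\<close>, \<open>LO j h\<close> and the assignment \<open>A h\<close>. It is a relation because
  ties in the choice of the core are broken arbitrarily.
\<close>

inductive fls :: "nat \<Rightarrow> demands \<Rightarrow> flow list \<Rightarrow>
    (nat \<Rightarrow> nat \<Rightarrow> nat) \<Rightarrow> (nat \<Rightarrow> nat \<Rightarrow> nat) \<Rightarrow> (nat \<Rightarrow> flow set) \<Rightarrow> bool"
  for m :: nat and d :: demands where
  fls_init: "fls m d [] (\<lambda>i h. 0) (\<lambda>j h. 0) (\<lambda>h. {})"
| fls_step: "\<lbrakk>fls m d fs LI LO A; is_arg_min (\<lambda>h. LI i h + LO j h) (\<lambda>h. h \<in> {1..m}) h\<rbrakk> \<Longrightarrow>
    fls m d (fs @ [(i, j, k)])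
      (LI(i := (LI i)(h := LI i h + d i j k)))
      (LO(j := (LO j)(h := LO j h + d i j k)))
      (A(h := insert (i, j, k) (A h)))"

text \<open>
  The algorithm outputs only an assignment of flows to cores. The schedule it determines is one
  of minimum makespan among the feasible schedules that transmit the flows of \<open>A h\<close> on core \<open>h\<close>.
\<close>

definition follows :: "nat \<Rightarrow> (nat \<Rightarrow> flow set) \<Rightarrow> schedule \<Rightarrow> bool" where
  "follows m A \<sigma> \<longleftrightarrow> (\<forall>h\<in>{1..m}. \<forall>f\<in>A h. core \<sigma> f = h)"

definition assignment_schedule ::
    "nat \<Rightarrow> nat \<Rightarrow> nat \<Rightarrow> demands \<Rightarrow> (nat \<Rightarrow> flow set) \<Rightarrow> schedule \<Rightarrow> bool" where
  "assignment_schedule N m K d A \<sigma> \<longleftrightarrow>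
     is_arg_min (makespan N K d) (\<lambda>\<sigma>. feasible N m K d \<sigma> \<and> follows m A \<sigma>) \<sigma>"

end

theory Submission
  imports Defs
begin

text \<open>
  Sending every flow at the constant rate \<open>d / L\<close>, where \<open>L\<close> is the maximal load of a port of a
  core, shows that the best makespan of an assignment is exactly \<open>L\<close>. Suppose FLS puts a flow of
  size \<open>x\<close> from \<open>i\<close> to \<open>j\<close> on core \<open>h\<close>. The chosen core minimises \<open>LI i h + LO j h\<close>, so
  this sum is at most the average over all cores. The total demands of the ports \<open>i\<close> and \<open>j\<close> are
  each at most \<open>m T\<^sup>*\<close> and include \<open>x\<close>, so the average is at most \<open>2 T\<^sup>* - 2 x / m\<close>. As
  \<open>x \<le> T\<^sup>*\<close>, for \<open>m \<ge> 2\<close> the new loads are at most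
  \<open>2 T\<^sup>* + (1 - 2 / m) x \<le> (3 - 2 / m) T\<^sup>*\<close>; for \<open>m = 1\<close> every assignment is optimal.
\<close>

section \<open>Port loads and a uniform view of feasibility\<close>

definition demand :: "demands \<Rightarrow> flow \<Rightarrow> nat" where
  "demand d f = (case f of (i, j, k) \<Rightarrow> d i j k)"

text \<open>The selector \<open>p\<close> is \<open>fst\<close> for input ports and \<open>fst \<circ> snd\<close> for output ports.\<close>

definition load ::
    "demands \<Rightarrow> flow set \<Rightarrow> (flow \<Rightarrow> nat) \<Rightarrow> (flow \<Rightarrow> nat) \<Rightarrow> nat \<Rightarrow> nat \<Rightarrow> nat" where
  "load d F c p x h = sum (demand d) {f \<in> F. p f = x \<and> c f = h}"

lemma finite_flows [simp]: "finite (flows N K d)"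
proof (rule finite_subset)
  show "flows N K d \<subseteq> {1..N} \<times> {1..N} \<times> {1..K}"
    by (auto simp: flows_def)
qed simp

text \<open>Merges the input and output capacity constraints into one condition on the selector
  \<open>p\<close>, so that later arguments treat both sides at once.\<close>

lemma feasible_iff:
  "feasible N m K d \<sigma> \<longleftrightarrow>
     (\<forall>f\<in>flows N K d. core \<sigma> f \<in> {1..m}) \<and>
     (\<forall>f\<in>flows N K d. \<forall>t\<ge>0. rate \<sigma> f t \<ge> 0 \<and> rate \<sigma> f integrable_on {0..t}) \<and>
     (\<forall>p\<in>{fst, fst \<circ> snd}. \<forall>h\<in>{1..m}. \<forall>x\<in>{1..N}. \<forall>t\<ge>0.
        (\<Sum>f\<in>{f \<in> flows N K d. p f = x \<and> core \<sigma> f = h}. rate \<sigma> f t) \<le> 1) \<and>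
     (\<forall>f\<in>flows N K d. \<exists>t\<ge>0. transmitted \<sigma> f t \<ge> real (demand d f))"
proof -
  have "{(i', j, k)\<in>flows N K d. i' = i \<and> core \<sigma> (i', j, k) = h}
      = {f \<in> flows N K d. fst f = i \<and> core \<sigma> f = h}" for i h
    by auto
  moreover have "{(i, j', k)\<in>flows N K d. j' = j \<and> core \<sigma> (i, j', k) = h}
      = {f \<in> flows N K d. (fst \<circ> snd) f = j \<and> core \<sigma> f = h}" for j h
    by auto
  ultimately show ?thesis
    unfolding feasible_def demand_def by (simp add: case_prod_unfold)
qed

section \<open>Lower bounds on the makespan of a feasible schedule\<close>

lemma makespan_nonneg: "0 \<le> makespan N K d \<sigma>"
  unfolding makespan_def by (rule Max_ge) auto

lemma flow_completion_le_makespan: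
  assumes "f \<in> flows N K d"
  shows "flow_completion d \<sigma> f \<le> makespan N K d \<sigma>"
proof -
  obtain i j k where f: "f = (i, j, k)" by (cases f)
  have k: "k \<in> {1..K}" using assms by (auto simp: flows_def f)
  have "finite {(i, j, k')\<in>flows N K d. k' = k}"
    by (rule finite_subset[OF _ finite_flows[of N K d]]) auto
  then have "flow_completion d \<sigma> f \<le> coflow_completion N K d \<sigma> k"
    unfolding coflow_completion_def using assms f by (intro Max_ge) auto
  also have "\<dots> \<le> makespan N K d \<sigma>"
    unfolding makespan_def using k by (intro Max_ge) auto
  finally show ?thesis .
qed

lemma makespan_leI:
  assumes "0 \<le> L" and "\<And>f. f \<in> flows N K d \<Longrightarrow> flow_completion d \<sigma> f \<le> L"
  shows "makespan N K d \<sigma> \<le> L"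
proof -
  have "coflow_completion N K d \<sigma> k \<le> L" for k
  proof -
    have "finite {(i, j, k')\<in>flows N K d. k' = k}"
      by (rule finite_subset[OF _ finite_flows[of N K d]]) auto
    then show ?thesis
      unfolding coflow_completion_def using assms by (subst Max_le_iff) auto
  qed
  then show ?thesis
    unfolding makespan_def using assms by (subst Max_le_iff) auto
qed

text \<open>Since \<open>t\<close> lies strictly above the infimum, all data of \<open>f\<close> has
  been sent at some earlier time \<open>s\<close>, and nonnegative rates preserve this until
  \<open>t\<close>.\<close>

lemma demand_le_transmitted:
  assumes feas: "feasible N m K d \<sigma>" and f: "f \<in> flows N K d" and t: "makespan N K d \<sigma> < t"
  shows "real (demand d f) \<le> transmitted \<sigma> f t"
proof -
  let ?S = "{t. t \<ge> 0 \<and> transmitted \<sigma> f t \<ge> real (demand d f)}"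
  have "?S \<noteq> {}" using feas f unfolding feasible_iff by auto
  moreover have "Inf ?S < t"
    using flow_completion_le_makespan[OF f, of \<sigma>] t
    by (simp add: flow_completion_def demand_def case_prod_unfold)
  ultimately obtain s where s: "s \<in> ?S" "s < t"
    by (metis cInf_lessD)
  have "integral {0..s} (rate \<sigma> f) \<le> integral {0..t} (rate \<sigma> f)"
  proof (rule integral_subset_le)
    show "rate \<sigma> f integrable_on {0..s}" and "rate \<sigma> f integrable_on {0..t}"
      using feas f s unfolding feasible_iff by fastforce+
    show "\<forall>r\<in>{0..t}. 0 \<le> rate \<sigma> f r"
      using feas f unfolding feasible_iff by auto
  qed (use s in auto)
  then show ?thesis
    using s by (simp add: transmitted_def)
qed

text \<open>Flows with joint rate at most 1 send at most \<open>t\<close> units by time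
  \<open>t\<close>. This is used for every \<open>t\<close> above the makespan, and density of the
  reals closes the gap.\<close>

lemma sum_demand_le_makespan:
  assumes feas: "feasible N m K d \<sigma>" and S: "S \<subseteq> flows N K d"
    and cap: "\<And>t. 0 \<le> t \<Longrightarrow> (\<Sum>f\<in>S. rate \<sigma> f t) \<le> 1"
  shows "real (sum (demand d) S) \<le> makespan N K d \<sigma>"
proof (rule dense_ge)
  fix t assume t: "makespan N K d \<sigma> < t"
  then have t0: "0 \<le> t" using makespan_nonneg[of N K d \<sigma>] by linarith
  have fin: "finite S" using S by (rule finite_subset) simp
  have int: "rate \<sigma> f integrable_on {0..t}" if "f \<in> S" for f
    using feas S that t0 unfolding feasible_iff by blast
  have "real (sum (demand d) S) \<le> (\<Sum>f\<in>S. integral {0..t} (rate \<sigma> f))"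
    using demand_le_transmitted[OF feas _ t] S
    by (auto simp: transmitted_def intro!: sum_mono)
  also have "\<dots> = integral {0..t} (\<lambda>s. \<Sum>f\<in>S. rate \<sigma> f s)"
    using int fin by (simp add: integral_sum)
  also have "\<dots> \<le> integral {0..t} (\<lambda>s. 1)"
    using int fin cap by (intro integral_le integrable_sum) auto
  also have "\<dots> = t" using t0 by simp
  finally show "real (sum (demand d) S) \<le> t" .
qed

lemma load_le_makespan:
  assumes "feasible N m K d \<sigma>" and "p \<in> {fst, fst \<circ> snd}" and "h \<in> {1..m}" and "x \<in> {1..N}"
  shows "real (load d (flows N K d) (core \<sigma>) p x h) \<le> makespan N K d \<sigma>"
  unfolding load_def
  using assms by (intro sum_demand_le_makespan[OF assms(1)]) (auto simp: feasible_iff)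

lemma sum_load:
  assumes "finite F" and "\<And>f. f \<in> F \<Longrightarrow> c f \<in> {1..m}"
  shows "(\<Sum>h\<in>{1..m}. load d F c p x h) = sum (demand d) {f \<in> F. p f = x}"
proof -
  have "(\<Sum>h\<in>{1..m}. load d F c p x h)
      = (\<Sum>h\<in>{1..m}. sum (demand d) {f \<in> {f \<in> F. p f = x}. c f = h})"
    by (simp add: load_def)
  also have "\<dots> = sum (demand d) {f \<in> F. p f = x}"
    using assms by (intro sum.group) auto
  finally show ?thesis .
qed

text \<open>Port \<open>x\<close> exists on \<open>m\<close> cores, and the load of each copy is at
  most the makespan.\<close>

lemma port_demand_le_makespan:
  assumes feas: "feasible N m K d \<sigma>" and p: "p \<in> {fst, fst \<circ> snd}" and x: "x \<in> {1..N}"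
  shows "real (sum (demand d) {f \<in> flows N K d. p f = x}) \<le> real m * makespan N K d \<sigma>"
proof -
  have "real (sum (demand d) {f \<in> flows N K d. p f = x})
      = (\<Sum>h\<in>{1..m}. real (load d (flows N K d) (core \<sigma>) p x h))"
    using feas by (subst sum_load[symmetric, of _ "core \<sigma>" m]) (auto simp: feasible_iff)
  also have "\<dots> \<le> (\<Sum>h\<in>{1..m}. makespan N K d \<sigma>)"
    using load_le_makespan[OF feas p _ x] by (intro sum_mono) auto
  finally show ?thesis by simp
qed

text \<open>Unsplittability enters here: all of \<open>f\<close> counts toward the load of its input
  port on a single core.\<close>

lemma demand_le_makespan:
  assumes feas: "feasible N m K d \<sigma>" and f: "f \<in> flows N K d"
  shows "real (demand d f) \<le> makespan N K d \<sigma>"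
proof -
  have h: "core \<sigma> f \<in> {1..m}" and x: "fst f \<in> {1..N}"
    using feas f by (auto simp: feasible_iff flows_def)
  have "demand d f \<le> load d (flows N K d) (core \<sigma>) fst (fst f) (core \<sigma> f)"
    unfolding load_def using f by (intro member_le_sum) auto
  then show ?thesis
    using load_le_makespan[OF feas _ h x, of fst] by simp
qed

section \<open>Realising a given assignment of flows to cores\<close>

text \<open>With rates proportional to demand, the total rate at a port is its load divided by
  \<open>L\<close>, and every flow is complete by time \<open>L\<close>.\<close>

lemma proportional_schedule:
  fixes L :: real
  assumes L0: "0 \<le> L" and c: "\<And>f. f \<in> flows N K d \<Longrightarrow> c f \<in> {1..m}"
    and L: "\<And>p x h. \<lbrakk>p \<in> {fst, fst \<circ> snd}; x \<in> {1..N}; h \<in> {1..m}\<rbrakk>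
      \<Longrightarrow> real (load d (flows N K d) c p x h) \<le> L"
  defines "\<sigma> \<equiv> \<lparr>core = c, rate = \<lambda>f t. real (demand d f) / L\<rparr>"
  shows "feasible N m K d \<sigma>" and "makespan N K d \<sigma> \<le> L"
proof -
  have transmitted: "transmitted \<sigma> f L \<ge> real (demand d f)" if f: "f \<in> flows N K d" for f
  proof -
    have "demand d f \<le> load d (flows N K d) c fst (fst f) (c f)"
      unfolding load_def using f by (intro member_le_sum) auto
    moreover have "real (load d (flows N K d) c fst (fst f) (c f)) \<le> L"
      using f c[OF f] by (intro L) (auto simp: flows_def)
    \<comment> \<open>A flow has positive demand, so the degenerate case \<open>L = 0\<close> occurs
      only without flows.\<close>
    moreover have "demand d f > 0" using f by (auto simp: flows_def demand_def)
    ultimately have "L > 0" by linarith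
    then show ?thesis by (simp add: transmitted_def \<sigma>_def)
  qed
  have "(\<Sum>f\<in>{f \<in> flows N K d. p f = x \<and> c f = h}. real (demand d f) / L) \<le> 1"
    if "p \<in> {fst, fst \<circ> snd}" "x \<in> {1..N}" "h \<in> {1..m}" for p x h
    using L[OF that] L0
    by (auto simp: load_def sum_divide_distrib[symmetric] divide_le_eq_1)
  then show "feasible N m K d \<sigma>"
    unfolding feasible_iff using c transmitted L0 by (auto simp: \<sigma>_def)
  show "makespan N K d \<sigma> \<le> L"
  proof (rule makespan_leI[OF L0])
    fix f assume "f \<in> flows N K d"
    then have "Inf {t. t \<ge> 0 \<and> transmitted \<sigma> f t \<ge> real (demand d f)} \<le> L"
      using transmitted L0 by (intro cInf_lower bdd_belowI[of _ 0]) auto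
    then show "flow_completion d \<sigma> f \<le> L"
      by (simp add: flow_completion_def demand_def case_prod_unfold)
  qed
qed

section \<open>Loads built up by the greedy algorithm\<close>

lemma load_insert:
  assumes "finite F" and "f \<notin> F"
  shows "load d (insert f F) (c(f := h)) p x h'
    = load d F c p x h' + (if p f = x \<and> h = h' then demand d f else 0)"
proof -
  have "{g \<in> insert f F. p g = x \<and> (c(f := h)) g = h'}
      = {g \<in> F. p g = x \<and> c g = h'} \<union> (if p f = x \<and> h = h' then {f} else {})"
    using assms by auto
  then show ?thesis
    using assms by (simp add: load_def)
qed

text \<open>Replaces the step-by-step bookkeeping by one core function \<open>c\<close>.
  Distinctness keeps a flow from landing on two cores or being counted twice.\<close>

lemma fls_assignment:
  assumes "fls m d fs LI LO A" and "distinct fs"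
  shows "\<exists>c. (\<forall>f\<in>set fs. c f \<in> {1..m}) \<and> A = (\<lambda>h. {f \<in> set fs. c f = h}) \<and>
    LI = load d (set fs) c fst \<and> LO = load d (set fs) c (fst \<circ> snd)"
  using assms
proof induction
  case fls_init
  show ?case by (auto simp: load_def fun_eq_iff)
next
  case (fls_step fs LI LO A i j h k)
  let ?f = "(i, j, k)"
  have "distinct fs" using fls_step.prems by simp
  from fls_step.IH[OF this] obtain c
    where c: "\<forall>f\<in>set fs. c f \<in> {1..m}" "A = (\<lambda>h. {f \<in> set fs. c f = h})"
      "LI = load d (set fs) c fst" "LO = load d (set fs) c (fst \<circ> snd)" by blast
  have new: "?f \<notin> set fs" and h: "h \<in> {1..m}"
    using fls_step by (auto simp: is_arg_min_def)
  show ?case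
  proof (intro exI[of _ "c(?f := h)"] conjI)
    show "\<forall>f\<in>set (fs @ [?f]). (c(?f := h)) f \<in> {1..m}"
      using c(1) h by auto
    show "A(h := insert ?f (A h)) = (\<lambda>h'. {f \<in> set (fs @ [?f]). (c(?f := h)) f = h'})"
      using new by (auto simp: c(2) fun_eq_iff)
    show "LI(i := (LI i)(h := LI i h + d i j k)) = load d (set (fs @ [?f])) (c(?f := h)) fst"
      using new by (auto simp: c(3) fun_eq_iff load_insert demand_def)
    show "LO(j := (LO j)(h := LO j h + d i j k))
        = load d (set (fs @ [?f])) (c(?f := h)) (fst \<circ> snd)"
      using new by (auto simp: c(4) fun_eq_iff load_insert demand_def)
  qed
qed

text \<open>\<open>a\<close> and \<open>b\<close> are the loads of the chosen core at the port to be
  bounded and at the other port; \<open>SI\<close> and \<open>SO\<close> are the totals of these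
  ports before a flow of size \<open>x\<close> is added.\<close>

lemma greedy_load_bound:
  fixes a b x SI SO T :: real and m :: nat
  assumes m: "m \<ge> 1" and avg: "real m * (a + b) \<le> SI + SO"
    and SI: "SI + x \<le> real m * T" and SO: "SO + x \<le> real m * T"
    and x: "x \<le> T" and a: "a \<le> SI" and b: "0 \<le> b"
  shows "a + x \<le> (3 - 2 / real m) * T"
proof (cases "m = 1")
  case True
  then show ?thesis using a SI by simp
next
  case False
  then have m2: "real m \<ge> 2" using m by simp
  have "real m * (a + x) \<le> real m * (a + b) + real m * x"
    using b by (simp add: algebra_simps)
  \<comment> \<open>Adding the two port bounds gives \<open>SI + SO \<le> 2 * m * T - 2 * x\<close>,
    which lowers the coefficient of \<open>x\<close> to \<open>m - 2\<close>. It is nonnegative, so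
    \<open>x \<le> T\<close> applies next.\<close>
  also have "\<dots> \<le> 2 * real m * T + (real m - 2) * x"
    using avg SI SO by (simp add: algebra_simps)
  also have "\<dots> \<le> 2 * real m * T + (real m - 2) * T"
    using m2 x by (simp add: mult_left_mono)
  also have "\<dots> = real m * ((3 - 2 / real m) * T)"
    using m2 by (simp add: field_simps)
  finally show ?thesis using m2 by simp
qed

text \<open>The hypotheses on port totals and single demands mention only \<open>fs\<close> and
  \<open>T\<close>, not a schedule, so they pass to prefixes and allow induction.\<close>

lemma fls_load_bound:
  fixes T :: real
  assumes "fls m d fs LI LO A" and "distinct fs" and m: "m \<ge> 1" and T: "0 \<le> T"
    and "\<And>p f. \<lbrakk>p \<in> {fst, fst \<circ> snd}; f \<in> set fs\<rbrakk>
      \<Longrightarrow> real (sum (demand d) {g \<in> set fs. p g = p f}) \<le> real m * T"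
    and "\<And>f. f \<in> set fs \<Longrightarrow> real (demand d f) \<le> T"
  shows "(\<forall>x h. real (LI x h) \<le> (3 - 2 / real m) * T) \<and>
    (\<forall>x h. real (LO x h) \<le> (3 - 2 / real m) * T)"
  using assms(1,2,5,6)
proof induction
  case fls_init
  have "2 / real m \<le> 2" using m by (simp add: field_simps)
  then have "0 \<le> (3 - 2 / real m) * T" using T by (intro mult_nonneg_nonneg) auto
  then show ?case by simp
next
  case (fls_step fs LI LO A i j h k)
  let ?f = "(i, j, k)"
  let ?S = "\<lambda>p. sum (demand d) {g \<in> set fs. p g = p ?f}"
  have new: "?f \<notin> set fs" and h: "h \<in> {1..m}"
    and min: "\<And>h'. h' \<in> {1..m} \<Longrightarrow> LI i h + LO j h \<le> LI i h' + LO j h'"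
    using fls_step.prems fls_step.hyps(2) by (auto simp: is_arg_min_linorder)
  from fls_step have "distinct fs" by simp
  from fls_assignment[OF fls_step.hyps(1) this] obtain c
    where c: "\<And>f. f \<in> set fs \<Longrightarrow> c f \<in> {1..m}"
      "LI = load d (set fs) c fst" "LO = load d (set fs) c (fst \<circ> snd)" by blast
  have sum_LI: "(\<Sum>h\<in>{1..m}. LI i h) = ?S fst"
    using sum_load[of "set fs" c m d fst i] c(1) by (simp add: c(2))
  have sum_LO: "(\<Sum>h\<in>{1..m}. LO j h) = ?S (fst \<circ> snd)"
    using sum_load[of "set fs" c m d "fst \<circ> snd" j] c(1) by (simp add: c(3))
  have "m * (LI i h + LO j h) = (\<Sum>h'\<in>{1..m}. LI i h + LO j h)" by simp
  also have "\<dots> \<le> (\<Sum>h'\<in>{1..m}. LI i h' + LO j h')"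
    using min by (intro sum_mono) auto
  also have "\<dots> = ?S fst + ?S (fst \<circ> snd)"
    by (simp only: sum.distrib sum_LI sum_LO)
  finally have "real (m * (LI i h + LO j h)) \<le> real (?S fst + ?S (fst \<circ> snd))"
    by (rule of_nat_mono)
  then have avg: "real m * (real (LI i h) + real (LO j h))
      \<le> real (?S fst) + real (?S (fst \<circ> snd))"
    by (simp only: of_nat_mult of_nat_add)
  \<comment> \<open>\<open>?S p\<close> omits the new flow, which the hypothesis on the extended
    list counts.\<close>
  have port: "real (?S p) + real (demand d ?f) \<le> real m * T" if "p \<in> {fst, fst \<circ> snd}" for p
  proof -
    have "{g \<in> set (fs @ [?f]). p g = p ?f} = insert ?f {g \<in> set fs. p g = p ?f}" by auto
    then show ?thesis
      using fls_step.prems(2)[OF that, of ?f] new by simp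
  qed
  note portI = port[OF insertI1] and portO = port[OF insertI2[OF singletonI]]
  \<comment> \<open>The same average with the ports exchanged, for bounding the output load.\<close>
  note avg' = avg[unfolded add.commute[of "real (LI i h)"] add.commute[of "real (?S fst)"]]
  have x: "real (demand d ?f) \<le> T" using fls_step.prems(3) by simp
  have aI: "real (LI i h) \<le> real (?S fst)" and aO: "real (LO j h) \<le> real (?S (fst \<circ> snd))"
    unfolding sum_LI[symmetric] sum_LO[symmetric] of_nat_le_iff
    using h by (auto intro: member_le_sum)
  have sub: "real (sum (demand d) {g \<in> set fs. p g = p f}) \<le> real m * T"
    if "p \<in> {fst, fst \<circ> snd}" "f \<in> set fs" for p f
  proof -
    have "sum (demand d) {g \<in> set fs. p g = p f}
        \<le> sum (demand d) {g \<in> set (fs @ [?f]). p g = p f}"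
      by (intro sum_mono2) auto
    then have "real (sum (demand d) {g \<in> set fs. p g = p f})
        \<le> real (sum (demand d) {g \<in> set (fs @ [?f]). p g = p f})"
      by (rule of_nat_mono)
    also have "\<dots> \<le> real m * T"
      using that by (intro fls_step.prems(2)) auto
    finally show ?thesis .
  qed
  have IH: "(\<forall>x h. real (LI x h) \<le> (3 - 2 / real m) * T) \<and>
      (\<forall>x h. real (LO x h) \<le> (3 - 2 / real m) * T)"
    using fls_step.prems(3) by (intro fls_step.IH[OF \<open>distinct fs\<close>] sub) auto
  have "real (LI i h) + real (demand d ?f) \<le> (3 - 2 / real m) * T"
    by (rule greedy_load_bound[OF m avg portI portO x aI]) simp
  moreover have "real (LO j h) + real (demand d ?f) \<le> (3 - 2 / real m) * T"
    by (rule greedy_load_bound[OF m avg' portO portI x aO]) simp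
  \<comment> \<open>Only the entries \<open>LI i h\<close> and \<open>LO j h\<close> change; the
    induction hypothesis covers all others.\<close>
  ultimately show ?case
    using IH by (simp add: demand_def)
qed

theorem theorem1:
  fixes N m K :: nat and d :: demands and fs :: "flow list"
    and LI LO :: "nat \<Rightarrow> nat \<Rightarrow> nat" and A :: "nat \<Rightarrow> flow set"
  assumes "m \<ge> 1"
    and "distinct fs" and "set fs = flows N K d"
    and "fls m d fs LI LO A"
  shows "(\<exists>\<sigma>. assignment_schedule N m K d A \<sigma>) \<and>
    (\<forall>\<sigma>. assignment_schedule N m K d A \<sigma> \<longrightarrow>
       makespan N K d \<sigma> \<le> (3 - 2 / real m) * opt_makespan N m K d)"
proof -
  let ?F = "flows N K d" and ?P = "{fst, fst \<circ> snd} :: (flow \<Rightarrow> nat) set"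
  obtain c where c: "\<And>f. f \<in> ?F \<Longrightarrow> c f \<in> {1..m}" "A = (\<lambda>h. {f \<in> ?F. c f = h})"
    "LI = load d ?F c fst" "LO = load d ?F c (fst \<circ> snd)"
    using fls_assignment[OF assms(4,2)] unfolding assms(3) by blast
  \<comment> \<open>The added 0 keeps \<open>M\<close> nonempty when \<open>N = 0\<close>.\<close>
  define M where "M = insert 0 ((\<lambda>(p, x, h). real (load d ?F c p x h)) ` (?P \<times> {1..N} \<times> {1..m}))"
  define L where "L = Max M"
  have finM: "finite M" by (simp add: M_def)
  have L0: "0 \<le> L" unfolding L_def using finM by (intro Max_ge) (auto simp: M_def)
  have load_le: "real (load d ?F c p x h) \<le> L" if "p \<in> ?P" "x \<in> {1..N}" "h \<in> {1..m}" for p x h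
    unfolding L_def using finM that by (intro Max_ge) (force simp: M_def)+
  have L_le: "L \<le> B" if "0 \<le> B"
    "\<And>p x h. \<lbrakk>p \<in> ?P; x \<in> {1..N}; h \<in> {1..m}\<rbrakk> \<Longrightarrow> real (load d ?F c p x h) \<le> B" for B
    unfolding L_def using finM that by (subst Max_le_iff) (auto simp: M_def)

  define \<sigma>\<^sub>0 where "\<sigma>\<^sub>0 = \<lparr>core = c, rate = \<lambda>f t. real (demand d f) / L\<rparr>"
  have feas0: "feasible N m K d \<sigma>\<^sub>0" and mk0: "makespan N K d \<sigma>\<^sub>0 \<le> L"
    using proportional_schedule[OF L0 c(1) load_le] by (auto simp: \<sigma>\<^sub>0_def)
  have follows0: "follows m A \<sigma>\<^sub>0" by (simp add: follows_def c(2) \<sigma>\<^sub>0_def)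
  \<comment> \<open>A schedule following \<open>A\<close> uses the cores given by \<open>c\<close>,
    so its loads are those that define \<open>L\<close>. Hence \<open>\<sigma>\<^sub>0\<close> is
    optimal for \<open>A\<close>.\<close>
  have lower: "L \<le> makespan N K d \<sigma>" if feas: "feasible N m K d \<sigma>" and fol: "follows m A \<sigma>" for \<sigma>
  proof (rule L_le[OF makespan_nonneg])
    fix p :: "flow \<Rightarrow> nat" and x h
    assume *: "p \<in> ?P" "x \<in> {1..N}" "h \<in> {1..m}"
    have "core \<sigma> f = c f" if "f \<in> ?F" for f
      using fol c(1)[OF that] that unfolding follows_def c(2) by blast
    then have "{f \<in> ?F. p f = x \<and> core \<sigma> f = h} = {f \<in> ?F. p f = x \<and> c f = h}" by auto
    then show "real (load d ?F c p x h) \<le> makespan N K d \<sigma>"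
      using load_le_makespan[OF feas *(1,3,2)] by (simp add: load_def)
  qed
  have ex: "assignment_schedule N m K d A \<sigma>\<^sub>0"
    unfolding assignment_schedule_def is_arg_min_linorder
    using feas0 follows0 mk0 lower by force

  have pos: "0 < 3 - 2 / real m"
  proof -
    have "2 / real m \<le> 2" using assms(1) by (simp add: field_simps)
    then show ?thesis by linarith
  qed
  have "L \<le> (3 - 2 / real m) * makespan N K d \<sigma>" if feas: "feasible N m K d \<sigma>" for \<sigma>
  proof -
    have "p f \<in> {1..N}" if "p \<in> ?P" "f \<in> ?F" for p f
      using that by (auto simp: flows_def)
    then have "(\<forall>x h. real (LI x h) \<le> (3 - 2 / real m) * makespan N K d \<sigma>) \<and>
        (\<forall>x h. real (LO x h) \<le> (3 - 2 / real m) * makespan N K d \<sigma>)"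
      by (intro fls_load_bound[OF assms(4,2,1) makespan_nonneg]; unfold assms(3))
        (intro port_demand_le_makespan[OF feas] demand_le_makespan[OF feas]; blast)+
    then show ?thesis
      using pos makespan_nonneg[of N K d \<sigma>] by (intro L_le) (auto simp: c(3,4))
  qed
  \<comment> \<open>Division by the positive factor gives a lower bound on all feasible makespans,
    hence on their infimum; \<open>\<sigma>\<^sub>0\<close> shows that there is one.\<close>
  then have "L / (3 - 2 / real m) \<le> opt_makespan N m K d"
    unfolding opt_makespan_def using feas0 pos
    by (intro cInf_greatest) (auto simp: pos_divide_le_eq mult.commute)
  then have "L \<le> (3 - 2 / real m) * opt_makespan N m K d"
    using pos by (simp add: pos_divide_le_eq mult.commute)
  \<comment> \<open>Every minimiser is compared with \<open>\<sigma>\<^sub>0\<close>.\<close>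
  moreover have "makespan N K d \<sigma> \<le> L" if "assignment_schedule N m K d A \<sigma>" for \<sigma>
    using that feas0 follows0 mk0
    unfolding assignment_schedule_def is_arg_min_linorder by force
  ultimately show ?thesis using ex by force
qed

end
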